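(* Let $(X,\Phi)$ be a flow and $A\subset X$ a regular open set. Then, for each $x\in\partial A$, $E_A(x)=x$ or $R_{\bar A}(x)=x$. Consequently, $\partial A=\mathrm{dom}\,E_A\cup\mathrm{dom}\,R_{\bar A}$.
   Context: A flow $(X,\Phi)$ on a topological space $X$ is a continuous map $\Phi:\mathbb{R}\times X\to X$ with $\Phi(0,x)=x$ and $\Phi(s+t,x)=\Phi(s,\Phi(t,x))$. An open set $A$ is regular if $\partial A=\partial\bar A$. A partial map is a map defined on a subset (its domain $\mathrm{dom}$) of its source; an equation such as $E_A(x)=x$ includes the assertion that $E_A$ is defined at $x$. First-out map: for an open set $A\subset X$, $E_A:\partial A\to\partial A$ is the partial map $E_A(x)=\Phi(T^e_A(x),x)$, where $T^e_A(x)=\inf\{t>0\mid\Phi(t,x)\notin A\}$; $x\in\mathrm{dom}\,E_A$ iff this set of times is nonempty. First-in map: for a closed set $B\subset X$, $R_B:\partial B\to\partial B$ is the partial map $R_B(x)=\Phi(T^r_B(x),x)$, where $T^r_B(x)=\inf\{t>0\mid\Phi(t,x)\in B\}$; $x\in\mathrm{dom}\,R_B$ iff this set of times is nonempty. *)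

theory Defs
  imports "HOL-Analysis.Analysis"
begin

text \<open>The phase space is the whole type \<open>'a\<close>, an arbitrary topological space
  without separation or countability assumptions.\<close>

definition flow :: "(real \<times> 'a \<Rightarrow> 'a::topological_space) \<Rightarrow> bool" where
  "flow \<Phi> \<longleftrightarrow> continuous_on UNIV \<Phi> \<and> (\<forall>x. \<Phi> (0, x) = x) \<and>
     (\<forall>s t x. \<Phi> (s + t, x) = \<Phi> (s, \<Phi> (t, x)))"

definition regular_open :: "'a::topological_space set \<Rightarrow> bool" where
  "regular_open A \<longleftrightarrow> open A \<and> frontier A = frontier (closure A)"

definition exit_times :: "(real \<times> 'a \<Rightarrow> 'a) \<Rightarrow> 'a set \<Rightarrow> 'a \<Rightarrow> real set" where
  "exit_times \<Phi> A x = {t. t > 0 \<and> \<Phi> (t, x) \<notin> A}"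

definition entry_times :: "(real \<times> 'a \<Rightarrow> 'a) \<Rightarrow> 'a set \<Rightarrow> 'a \<Rightarrow> real set" where
  "entry_times \<Phi> B x = {t. t > 0 \<and> \<Phi> (t, x) \<in> B}"

text \<open>Partial self-maps of the boundary. They are meant for open \<open>A\<close> and closed \<open>B\<close>
  respectively; the lemmas at the end show that the values then lie in the boundary again.\<close>

definition first_out :: "(real \<times> 'a \<Rightarrow> 'a) \<Rightarrow> 'a set \<Rightarrow> ('a::topological_space \<rightharpoonup> 'a)" where
  "first_out \<Phi> A = (\<lambda>x. if x \<in> frontier A \<and> exit_times \<Phi> A x \<noteq> {}
     then Some (\<Phi> (Inf (exit_times \<Phi> A x), x)) else None)"

definition first_in :: "(real \<times> 'a \<Rightarrow> 'a) \<Rightarrow> 'a set \<Rightarrow> ('a::topological_space \<rightharpoonup> 'a)" where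
  "first_in \<Phi> B = (\<lambda>x. if x \<in> frontier B \<and> entry_times \<Phi> B x \<noteq> {}
     then Some (\<Phi> (Inf (entry_times \<Phi> B x), x)) else None)"

lemma first_out_eq_first_in_Compl: "first_out \<Phi> A = first_in \<Phi> (- A)"
proof -
  have eq: "exit_times \<Phi> A = entry_times \<Phi> (- A)"
    by (simp add: fun_eq_iff exit_times_def entry_times_def)
  show ?thesis unfolding first_out_def first_in_def frontier_complement eq by (rule refl)
qed

lemma ran_first_in_subset:
  assumes "flow \<Phi>" and B: "closed B"
  shows "ran (first_in \<Phi> B) \<subseteq> frontier B"
proof
  fix y assume "y \<in> ran (first_in \<Phi> B)"
  then obtain x where x: "x \<in> frontier B" and ne: "entry_times \<Phi> B x \<noteq> {}"
    and y: "y = \<Phi> (Inf (entry_times \<Phi> B x), x)"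
    by (auto simp: ran_def first_in_def split: if_splits)
  have cont: "continuous_on UNIV \<Phi>" and init: "\<Phi> (0, x) = x"
    using assms(1) unfolding flow_def by blast+
  define S where "S = entry_times \<Phi> B x"
  define T where "T = Inf S"
  have c: "continuous_on UNIV (\<lambda>t. \<Phi> (t, x))"
    by (rule continuous_on_compose2[OF cont]) (auto intro!: continuous_intros)
  have bdd: "bdd_below S"
    by (rule bdd_belowI[of _ 0]) (auto simp: S_def entry_times_def)
  have T0: "T \<ge> 0"
    unfolding T_def using ne by (intro cInf_greatest) (auto simp: S_def entry_times_def)
  have "T \<in> closure S"
    unfolding T_def using ne bdd by (intro closure_contains_Inf) (auto simp: S_def)
  moreover have "closure S \<subseteq> (\<lambda>t. \<Phi> (t, x)) -` B"
    using c B by (intro closure_minimal closed_vimage) (auto simp: S_def entry_times_def)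
  ultimately have TB: "\<Phi> (T, x) \<in> B" by auto
  show "y \<in> frontier B"
  proof (cases "T = 0")
    case True
    then show ?thesis using x y init by (simp add: S_def T_def)
  next
    case False
    then have pos: "0 < T" using T0 by simp
    have "{0<..<T} \<subseteq> (\<lambda>t. \<Phi> (t, x)) -` closure (- B)"
    proof
      fix t assume t: "t \<in> {0<..<T}"
      then have "t \<notin> S" using cInf_lower[OF _ bdd, of t] by (auto simp: T_def)
      then show "t \<in> (\<lambda>t. \<Phi> (t, x)) -` closure (- B)"
        using t closure_subset[of "- B"] by (auto simp: S_def entry_times_def)
    qed
    then have "closure {0<..<T} \<subseteq> (\<lambda>t. \<Phi> (t, x)) -` closure (- B)"
      using c by (intro closure_minimal closed_vimage) auto
    moreover have "T \<in> closure {0<..<T}" using pos by simp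
    ultimately have "\<Phi> (T, x) \<in> closure (- B)" by blast
    then show ?thesis
      using TB B y by (simp add: frontier_closures closure_closed S_def T_def)
  qed
qed

lemma ran_first_out_subset:
  assumes "flow \<Phi>" and "open A"
  shows "ran (first_out \<Phi> A) \<subseteq> frontier A"
  using ran_first_in_subset[OF assms(1), of "- A"] assms(2)
  by (simp add: first_out_eq_first_in_Compl frontier_complement closed_Compl)

end

theory Submission
  imports Defs
begin

text \<open>At each positive time the orbit of x is outside A or in the closure of A, so exit times
  and entry times together cover the positive reals. Two sets with this union cannot both stay away
  from 0 (\<open>positive_reals_cover_Inf_eq_zero\<close>); the one that accumulates at 0 has
  infimum 0, and since \<Phi>(0, x) = x its map fixes x. Regularity places x on the frontier of the
  closure, where \<open>first_in\<close> can be defined.\<close>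

lemma Inf_eq_zero_of_arbitrarily_small:
  fixes S :: "real set"
  assumes "S \<subseteq> {0<..}" and "\<And>e. e > 0 \<Longrightarrow> \<exists>s\<in>S. s < e"
  shows "S \<noteq> {} \<and> Inf S = 0"
proof
  show "S \<noteq> {}" using assms(2)[of 1] by auto
  show "Inf S = 0"
  proof (rule cInf_eq)
    show "0 \<le> s" if "s \<in> S" for s using that assms(1) by auto
    show "y \<le> 0" if "\<And>s. s \<in> S \<Longrightarrow> y \<le> s" for y
      using assms(2)[of y] that by force
  qed
qed

text \<open>If S is bounded below by some d > 0, then T must contain the whole interval (0, d).
  Nonemptiness is recorded because it is the domain condition of the partial maps.\<close>

lemma positive_reals_cover_Inf_eq_zero:
  fixes S T :: "real set"
  assumes "S \<union> T = {0<..}"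
  shows "S \<noteq> {} \<and> Inf S = 0 \<or> T \<noteq> {} \<and> Inf T = 0"
proof (cases "\<forall>e>0. \<exists>s\<in>S. s < e")
  case True
  then have "S \<noteq> {} \<and> Inf S = 0"
    using assms by (intro Inf_eq_zero_of_arbitrarily_small) auto
  then show ?thesis ..
next
  case False
  then obtain d where d: "d > 0" "\<And>s. s \<in> S \<Longrightarrow> d \<le> s" by force
  have "\<exists>t\<in>T. t < e" if "e > 0" for e
  proof -
    \<comment> \<open>Being below d keeps this point out of S, hence in T; being below e makes it
      small enough.\<close>
    have "min d e / 2 \<in> S \<union> T" using d(1) that assms by simp
    moreover have "min d e / 2 < d" "min d e / 2 < e" using d(1) that by linarith+
    ultimately show ?thesis using d(2) by force
  qed
  then have "T \<noteq> {} \<and> Inf T = 0"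
    using assms by (intro Inf_eq_zero_of_arbitrarily_small) auto
  then show ?thesis ..
qed

theorem lemma3p11:
  fixes \<Phi> :: "real \<times> 'a::topological_space \<Rightarrow> 'a"
    and A :: "'a set"
  assumes "flow \<Phi>"
    and "regular_open A"
  shows "(\<forall>x\<in>frontier A. first_out \<Phi> A x = Some x \<or> first_in \<Phi> (closure A) x = Some x) \<and>
         frontier A = dom (first_out \<Phi> A) \<union> dom (first_in \<Phi> (closure A))"
proof -
  have fr: "frontier (closure A) = frontier A"
    using assms(2) by (simp add: regular_open_def)
  have init: "\<Phi> (0, x) = x" for x
    using assms(1) by (simp add: flow_def)
  have fix_point: "first_out \<Phi> A x = Some x \<or> first_in \<Phi> (closure A) x = Some x"
    if "x \<in> frontier A" for x
  proof -
    have "exit_times \<Phi> A x \<union> entry_times \<Phi> (closure A) x = {0<..}"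
      using closure_subset[of A] by (auto simp: exit_times_def entry_times_def)
    from positive_reals_cover_Inf_eq_zero[OF this] show ?thesis
      using that by (auto simp: first_out_def first_in_def fr init)
  qed
  moreover have "dom (first_out \<Phi> A) \<union> dom (first_in \<Phi> (closure A)) \<subseteq> frontier A"
    by (auto simp: first_out_def first_in_def fr split: if_splits)
  \<comment> \<open>A fixed point of a partial map lies in its domain, which gives the remaining
    inclusion.\<close>
  ultimately show ?thesis by blast
qed

end
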